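(* Let $Y$ be a positive real-valued random variable such that $X=\log Y$ has a probability density function $g:\mathbb{R}\to[0,\infty)$. Then $Y$ is scale-invariant if and only if $g^{\dagger}(x)=1$ for (Lebesgue) almost every $x\in[0,1)$.
   Context: Throughout, $\log$ denotes the base $10$ logarithm. For a function $g:\mathbb{R}\to[0,\infty)$, define $g^{\dagger}=g\ (\mathrm{mod}\ 1)$ by $g^{\dagger}(x)=\sum_{k=-\infty}^{\infty}g(x+k)$ for $x\in[0,1)$ and $g^{\dagger}(x)=0$ otherwise. For a real number $y>0$ and $i\ge 1$, $D_i(y)$ denotes the $i$-th significant decimal digit of $y$: writing $y=m\times 10^k$ with $k\in\mathbb{Z}$ and $1\le m<10$, $D_i(y)$ is the $i$-th digit of the decimal expansion of $m$ (not ending in all $9$s), so $D_1(y)=\lfloor m\rfloor\in\{1,\ldots,9\}$ and $D_i(y)\in\{0,\ldots,9\}$ for $i>1$; e.g. $D_1(2.718)=2$, $D_2(2.718)=7$. The random variable $Y$ is called scale-invariant if its digit distribution does not change when it is multiplied by a constant: for every constant $c>0$, every $n\ge1$, every $d_1\in\{1,\ldots,9\}$ and all $d_2,\ldots,d_n\in\{0,\ldots,9\}$, $P(D_1(cY)=d_1,\ldots,D_n(cY)=d_n)=P(D_1(Y)=d_1,\ldots,D_n(Y)=d_n)$. *)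

theory Defs
  imports "HOL-Probability.Probability"
begin

definition significand :: "real \<Rightarrow> real" where
  "significand y = (THE m. 1 \<le> m \<and> m < 10 \<and> (\<exists>k::int. y = m * 10 powi k))"

text \<open>Position \<open>i\<close> of a decimal expansion has weight \<open>10 ^ (- i)\<close>, so that position \<open>0\<close>
  is the integer part; this presupposes \<open>0 \<le> m < 10\<close>.\<close>

definition is_decimal_expansion :: "(nat \<Rightarrow> nat) \<Rightarrow> real \<Rightarrow> bool" where
  "is_decimal_expansion d m \<longleftrightarrow>
     (\<forall>i. d i \<in> {0..9}) \<and> (\<exists>\<^sub>\<infinity>i. d i \<noteq> 9) \<and> (\<lambda>i. real (d i) / 10 ^ i) sums m"

definition decimal_expansion :: "real \<Rightarrow> nat \<Rightarrow> nat" where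
  "decimal_expansion m = (THE d. is_decimal_expansion d m)"

text \<open>Significant digits are numbered from \<open>1\<close>; the value is only meaningful for \<open>i \<ge> 1\<close>
  and \<open>y > 0\<close>.\<close>

definition sig_digit :: "nat \<Rightarrow> real \<Rightarrow> nat" where
  "sig_digit i y = decimal_expansion (significand y) (i - 1)"

text \<open>The periodization is \<open>ennreal\<close>-valued because the series of nonnegative terms may diverge.\<close>

definition wrap_mod1 :: "(real \<Rightarrow> real) \<Rightarrow> real \<Rightarrow> ennreal" where
  "wrap_mod1 g x = (if x \<in> {0..<1} then \<Sum>\<^sub>\<infinity>k::int. ennreal (g (x + of_int k)) else 0)"

definition scale_invariant :: "'a measure \<Rightarrow> ('a \<Rightarrow> real) \<Rightarrow> bool" where
  "scale_invariant M Y \<longleftrightarrow>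
     (\<forall>c>0. \<forall>n\<ge>1. \<forall>d::nat \<Rightarrow> nat. d 1 \<in> {1..9} \<longrightarrow> (\<forall>i\<in>{2..n}. d i \<in> {0..9}) \<longrightarrow>
        \<P>(\<omega> in M. \<forall>i\<in>{1..n}. sig_digit i (c * Y \<omega>) = d i)
        = \<P>(\<omega> in M. \<forall>i\<in>{1..n}. sig_digit i (Y \<omega>) = d i))"

text \<open>The following facts show that the definite descriptions above are well-defined.\<close>

lemma significand_unique:
  fixes y :: real
  assumes "y > 0"
  shows "\<exists>!m. 1 \<le> m \<and> m < 10 \<and> (\<exists>k::int. y = m * 10 powi k)"
    and "significand y = y / 10 powi \<lfloor>log 10 y\<rfloor>"
proof -
  define k where "k = \<lfloor>log 10 y\<rfloor>"
  have k: "y / 10 powi k = 10 powr (log 10 y - of_int k)"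
    using assms by (simp add: powr_diff powr_real_of_int')
  have ex: "1 \<le> y / 10 powi k \<and> y / 10 powi k < 10 \<and> (\<exists>j::int. y = y / 10 powi k * 10 powi j)"
  proof (intro conjI exI)
    show "1 \<le> y / 10 powi k" unfolding k by (rule ge_one_powr_ge_zero) (auto simp: k_def)
    have "10 powr (log 10 y - of_int k) < 10 powr (1::real)"
      by (rule powr_less_mono) (auto simp: k_def, linarith)
    then show "y / 10 powi k < 10" unfolding k by simp
    show "y = y / 10 powi k * 10 powi k" by simp
  qed
  have un: "m = y / 10 powi k" if m: "1 \<le> m" "m < 10" "y = m * 10 powi j" for m :: real and j :: int
  proof -
    have "log 10 y = log 10 m + of_int j"
      using m by (simp add: log_mult powr_real_of_int' [symmetric])
    moreover have "0 \<le> log 10 m" "log 10 m < 1" using m by auto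
    ultimately have "k = j" unfolding k_def by linarith
    then show ?thesis using m by simp
  qed
  show ex1: "\<exists>!m. 1 \<le> m \<and> m < 10 \<and> (\<exists>k::int. y = m * 10 powi k)"
    using ex un by blast
  show "significand y = y / 10 powi \<lfloor>log 10 y\<rfloor>"
    unfolding significand_def k_def [symmetric]
    by (rule the1_equality [OF ex1]) (rule ex)
qed

lemma is_decimal_expansion_floor:
  assumes "is_decimal_expansion d m"
  shows "int (d n) = \<lfloor>m * 10 ^ n\<rfloor> mod 10"
proof -
  have d9: "d i \<le> 9" for i using assms by (auto simp: is_decimal_expansion_def)
  have inf: "\<exists>\<^sub>\<infinity>i. d i \<noteq> 9" and s: "(\<lambda>i. real (d i) / 10 ^ i) sums m"
    using assms by (auto simp: is_decimal_expansion_def)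
  define N where "N = (\<Sum>i\<le>n. int (d i) * 10 ^ (n - i))"
  define t where "t = (\<lambda>j. real (d (j + Suc n)) / 10 ^ Suc j)"
  have "(\<lambda>j. real (d (j + Suc n)) / 10 ^ (j + Suc n)) sums (m - (\<Sum>i<Suc n. real (d i) / 10 ^ i))"
    using sums_split_initial_segment [OF s, of "Suc n"] by simp
  from sums_mult [OF this, of "10 ^ n"]
  have "t sums (10 ^ n * (m - (\<Sum>i<Suc n. real (d i) / 10 ^ i)))"
    by (simp add: t_def power_add)
  also have "10 ^ n * (m - (\<Sum>i<Suc n. real (d i) / 10 ^ i)) = m * 10 ^ n - of_int N"
  proof -
    have "(\<Sum>i\<le>n. 10 ^ n * (real (d i) / 10 ^ i)) = (\<Sum>i\<le>n. real (d i) * 10 ^ (n - i))"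
      by (rule sum.cong) (auto simp: power_diff)
    then show ?thesis
      by (simp add: N_def right_diff_distrib sum_distrib_left lessThan_Suc_atMost mult.commute del: sum.lessThan_Suc)
  qed
  finally have t: "t sums (m * 10 ^ n - of_int N)" .
  then have "0 \<le> m * 10 ^ n - of_int N"
    by (rule sums_le [OF _ sums_zero, rotated]) (simp add: t_def)
  moreover have "m * 10 ^ n - of_int N < 1"
  proof -
    have "(\<lambda>j. 9 / 10 * (1 / 10) ^ j :: real) sums (9 / 10 * (1 / (1 - 1 / 10)))"
      by (intro sums_mult geometric_sums) simp
    from sums_diff [OF this t]
    have e: "(\<lambda>j. (9 - real (d (j + Suc n))) / 10 ^ Suc j) sums (1 - (m * 10 ^ n - of_int N))"
      by (simp add: t_def field_simps)
    obtain i where i: "i \<ge> Suc n" "d i \<noteq> 9"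
      using inf by (auto simp: INFM_nat_le)
    have "0 < (\<Sum>j. (9 - real (d (j + Suc n))) / 10 ^ Suc j)"
    proof (rule suminf_pos2 [where i = "i - Suc n"])
      show "0 < (9 - real (d (i - Suc n + Suc n))) / 10 ^ Suc (i - Suc n)"
        using i d9 [of i] by (intro divide_pos_pos) auto
    next
      show "0 \<le> (9 - real (d (j + Suc n))) / 10 ^ Suc j" for j
        using d9 [of "j + Suc n"] by (intro divide_nonneg_pos) auto
    qed (use e in \<open>auto simp: sums_iff\<close>)
    then show ?thesis using e by (simp add: sums_iff)
  qed
  ultimately have fl: "\<lfloor>m * 10 ^ n\<rfloor> = N" by linarith
  have "N mod 10 = (\<Sum>i\<le>n. int (d i) * 10 ^ (n - i) mod 10) mod 10"
    unfolding N_def by (rule mod_sum_eq [symmetric])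
  also have "(\<Sum>i\<le>n. int (d i) * 10 ^ (n - i) mod 10) = (\<Sum>i\<le>n. if i = n then int (d n) else 0)"
  proof (rule sum.cong)
    fix i assume "i \<in> {..n}"
    then show "int (d i) * 10 ^ (n - i) mod 10 = (if i = n then int (d n) else 0)"
      using d9 [of n] by (cases "n - i") auto
  qed simp
  also have "\<dots> mod 10 = int (d n)" using d9 [of n] by simp
  finally show ?thesis using fl by simp
qed

lemma decimal_expansion_unique:
  fixes m :: real
  assumes "0 \<le> m" "m < 10"
  shows "\<exists>!d. is_decimal_expansion d m"
    and "decimal_expansion m n = nat (\<lfloor>m * 10 ^ n\<rfloor> mod 10)"
proof -
  define d where "d = (\<lambda>n. nat (\<lfloor>m * 10 ^ n\<rfloor> mod 10))"
  have dint: "int (d n) = \<lfloor>m * 10 ^ n\<rfloor> mod 10" for n by (simp add: d_def)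
  have step: "\<lfloor>m * 10 ^ Suc n\<rfloor> = 10 * \<lfloor>m * 10 ^ n\<rfloor> + int (d (Suc n))" for n
  proof -
    have "\<lfloor>m * 10 ^ Suc n\<rfloor> div 10 = \<lfloor>m * 10 ^ n\<rfloor>"
      using floor_divide_real_eq_div [of 10 "m * 10 ^ Suc n"] by simp
    then show ?thesis unfolding dint by (metis mult_div_mod_eq)
  qed
  have part: "(\<Sum>i\<le>n. real (d i) / 10 ^ i) = of_int \<lfloor>m * 10 ^ n\<rfloor> / 10 ^ n" for n
  proof (induction n)
    case 0
    have "0 \<le> \<lfloor>m\<rfloor>" "\<lfloor>m\<rfloor> < 10" using assms by linarith+
    then have "int (d 0) = \<lfloor>m\<rfloor>" unfolding dint by simp
    then have "real (d 0) = of_int \<lfloor>m\<rfloor>" by (metis of_int_of_nat_eq)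
    then show ?case by simp
  next
    case (Suc n)
    then show ?case unfolding step by (simp add: field_simps)
  qed
  have "(\<lambda>n. of_int \<lfloor>m * 10 ^ n\<rfloor> / 10 ^ n) \<longlonglongrightarrow> m"
  proof (rule tendsto_sandwich)
    show "\<forall>\<^sub>F n in sequentially. m - (1 / 10) ^ n \<le> of_int \<lfloor>m * 10 ^ n\<rfloor> / 10 ^ n"
    proof (intro always_eventually allI)
      fix n
      have "(m * 10 ^ n - 1) / 10 ^ n \<le> of_int \<lfloor>m * 10 ^ n\<rfloor> / 10 ^ n"
        by (rule divide_right_mono) (linarith, simp)
      then show "m - (1 / 10) ^ n \<le> of_int \<lfloor>m * 10 ^ n\<rfloor> / 10 ^ n"
        by (simp add: diff_divide_distrib power_one_over)
    qed
    show "\<forall>\<^sub>F n in sequentially. of_int \<lfloor>m * 10 ^ n\<rfloor> / 10 ^ n \<le> m"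
      by (intro always_eventually allI) (simp add: pos_divide_le_eq)
    have "(\<lambda>n. (1 / 10) ^ n :: real) \<longlonglongrightarrow> 0" by (rule LIMSEQ_power_zero) simp
    from tendsto_diff [OF tendsto_const this] show "(\<lambda>n. m - (1 / 10) ^ n) \<longlonglongrightarrow> m" by simp
  qed simp
  then have s: "(\<lambda>i. real (d i) / 10 ^ i) sums m"
    unfolding sums_def_le part .
  have inf: "\<exists>\<^sub>\<infinity>i. d i \<noteq> 9"
  proof (rule ccontr)
    assume "\<not> (\<exists>\<^sub>\<infinity>i. d i \<noteq> 9)"
    then obtain N where N: "\<And>i. i \<ge> N \<Longrightarrow> d i = 9"
      by (auto simp: INFM_nat_le)
    define \<epsilon> where "\<epsilon> = of_int \<lfloor>m * 10 ^ N\<rfloor> + 1 - m * 10 ^ N"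
    have "of_int \<lfloor>m * 10 ^ (N + j)\<rfloor> + 1 = (of_int \<lfloor>m * 10 ^ N\<rfloor> + 1) * (10 ^ j :: real)" for j
    proof (induction j)
      case (Suc j)
      have "d (Suc (N + j)) = 9" using N by simp
      then show ?case using Suc step [of "N + j"] by (simp add: field_simps)
    qed simp
    then have eq: "\<epsilon> * 10 ^ j = of_int \<lfloor>m * 10 ^ (N + j)\<rfloor> + 1 - m * 10 ^ (N + j)" for j
      by (simp add: \<epsilon>_def power_add left_diff_distrib)
    have le: "\<epsilon> * 10 ^ j \<le> 1" for j
      using eq [of j] of_int_floor_le [of "m * 10 ^ (N + j)"] by linarith
    have "\<epsilon> > 0" unfolding \<epsilon>_def by linarith
    moreover obtain j where "1 / \<epsilon> < 10 ^ j" using real_arch_pow [of 10 "1 / \<epsilon>"] by auto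
    ultimately have "1 < \<epsilon> * 10 ^ j" by (simp add: field_simps)
    with le [of j] show False by simp
  qed
  have ex: "is_decimal_expansion d m"
  proof -
    have "d i \<le> 9" for i
      unfolding d_def using pos_mod_bound [of 10 "\<lfloor>m * 10 ^ i\<rfloor>"] by linarith
    then show ?thesis using s inf by (auto simp: is_decimal_expansion_def)
  qed
  have un: "e = d" if "is_decimal_expansion e m" for e
  proof
    fix n
    have "int (e n) = int (d n)" using is_decimal_expansion_floor [OF that, of n] dint [of n] by simp
    then show "e n = d n" by simp
  qed
  show ex1: "\<exists>!d. is_decimal_expansion d m" using ex un by blast
  have "decimal_expansion m = d"
    unfolding decimal_expansion_def using ex un by (rule the_equality)
  then show "decimal_expansion m n = nat (\<lfloor>m * 10 ^ n\<rfloor> mod 10)" by (simp add: d_def)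
qed

end

theory Submission
  imports Defs
begin

text \<open>
  Put \<open>X = log 10 Y\<close>. Multiplying \<open>Y\<close> by \<open>c\<close> translates \<open>X\<close> by \<open>log 10 c\<close>, and the significant
  digits of \<open>10 powr u\<close> depend only on \<open>u\<close> modulo \<open>1\<close>. So scale-invariance is a statement about
  how \<open>X\<close> is distributed on the circle: the law of \<open>a + X\<close> modulo \<open>1\<close> gives every digit event a
  probability that does not depend on \<open>a\<close>. On the circle \<open>X\<close> has density \<open>wrap_mod1 g\<close>, because
  integrating a \<open>1\<close>-periodic function against \<open>g\<close> is the same as integrating it over \<open>[0, 1)\<close>
  against \<open>wrap_mod1 g\<close> (\<open>nn_integral_wrap_mod1\<close>).

  If the wrapped density is \<open>1\<close>, the probability of a digit event at \<open>a + X\<close> is the integral of a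
  periodic indicator over a translated period, hence independent of \<open>a\<close>
  (\<open>nn_integral_period_translate\<close>).

  Conversely, if these probabilities do not depend on \<open>a\<close>, each of them equals its own average over
  \<open>a \<in> [0, 1)\<close>. By Fubini one may average over \<open>a\<close> first, for each fixed value of \<open>X\<close>, and
  that average is the Lebesgue measure of the event in \<open>[0, 1)\<close>, whatever the value of \<open>X\<close>
  (\<open>nn_integral_average_translations\<close>). Thus \<open>frac X\<close> and the uniform distribution on
  \<open>[0, 1)\<close> agree on all digit events. The first digits of a significand \<open>m\<close> amount to a
  truncation \<open>\<lfloor>m * 10 ^ n\<rfloor>\<close> (\<open>sig_digits_eq_iff\<close>), and the laws of these truncations determine
  the law of \<open>frac X\<close> (\<open>measure_eqI_truncations\<close>), which is therefore uniform. Comparing densities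
  yields \<open>wrap_mod1 g = 1\<close> almost everywhere on \<open>[0, 1)\<close>.
\<close>

section \<open>Periodic functions and wrapped densities\<close>

lemma borel_measurable_frac [measurable]: "(frac :: real \<Rightarrow> real) \<in> borel_measurable borel"
  unfolding frac_def [abs_def] by measurable

text \<open>Once the unordered sum over the translates is an integral against counting measure, the
  interchange of sum and integral is an instance of Tonelli's theorem.\<close>

lemma infsum_int_eq_nn_integral:
  fixes f :: "int \<Rightarrow> ennreal"
  shows "(\<Sum>\<^sub>\<infinity>k. f k) = (\<integral>\<^sup>+k. f k \<partial>count_space UNIV)"
proof -
  define e :: "nat \<Rightarrow> int" where "e = from_nat_into UNIV"
  have e: "bij_betw e UNIV UNIV"
    unfolding e_def by (rule bij_betw_from_nat_into) (auto simp: infinite_UNIV_int)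
  have "(\<Sum>\<^sub>\<infinity>k. f k) = (\<Sum>\<^sub>\<infinity>n. f (e n))"
    by (rule infsum_reindex_bij_betw [OF e, symmetric])
  also have "((\<lambda>n. f (e n)) has_sum (\<Sum>\<^sub>\<infinity>n. f (e n))) UNIV"
    by (intro has_sum_infsum nonneg_summable_on_complete) simp
  then have "(\<Sum>\<^sub>\<infinity>n. f (e n)) = (\<Sum>n. f (e n))"
    by (intro sums_unique has_sum_imp_sums)
  also have "\<dots> = (\<integral>\<^sup>+n. f (e n) \<partial>count_space UNIV)"
    by (rule nn_integral_count_space_nat [symmetric])
  also have "\<dots> = (\<integral>\<^sup>+k. f k \<partial>count_space UNIV)"
    by (rule nn_integral_bij_count_space [OF e])
  finally show ?thesis .
qed

lemma wrap_mod1_eq_nn_integral: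
  "wrap_mod1 g x = (\<integral>\<^sup>+k. ennreal (g (x + of_int k)) * indicator {0..<1} x \<partial>count_space UNIV)"
  by (simp add: wrap_mod1_def infsum_int_eq_nn_integral)

lemma borel_measurable_wrap_mod1 [measurable]:
  assumes [measurable]: "(\<lambda>x. ennreal (g x)) \<in> borel_measurable borel"
  shows "wrap_mod1 g \<in> borel_measurable borel"
proof -
  have [measurable]: "(\<lambda>x. ennreal (g (x + c))) \<in> borel_measurable borel" for c
    by (rule measurable_compose [of "\<lambda>x. x + c" _ borel]) measurable
  have e: "bij_betw (from_nat_into UNIV :: nat \<Rightarrow> int) UNIV UNIV"
    by (rule bij_betw_from_nat_into) (auto simp: infinite_UNIV_int)
  have "wrap_mod1 g x = (\<Sum>n. ennreal (g (x + of_int (from_nat_into UNIV n))) * indicator {0..<1} x)" for x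
    unfolding wrap_mod1_eq_nn_integral nn_integral_count_space_nat [symmetric]
    by (rule nn_integral_bij_count_space [OF e, symmetric])
  then have "wrap_mod1 g = (\<lambda>x. \<Sum>n. ennreal (g (x + of_int (from_nat_into UNIV n))) * indicator {0..<1} x)"
    by blast
  then show ?thesis by simp
qed

text \<open>Cut the line into the intervals \<open>[k, k + 1)\<close> and move each of them to \<open>[0, 1)\<close>. A periodic
  factor \<open>f\<close> does not notice the move, so the shifted copies of \<open>g\<close> add up to the wrapped
  density.\<close>

lemma nn_integral_wrap_mod1:
  fixes f :: "real \<Rightarrow> ennreal"
  assumes [measurable]: "(\<lambda>x. ennreal (g x)) \<in> borel_measurable borel" "f \<in> borel_measurable borel"
    and periodic: "\<And>x (k::int). f (x + of_int k) = f x"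
  shows "(\<integral>\<^sup>+x. ennreal (g x) * f x \<partial>lborel) = (\<integral>\<^sup>+x. wrap_mod1 g x * f x \<partial>lborel)"
proof -
  have part: "(\<integral>\<^sup>+k. indicator {0..<1} (x - of_int k) \<partial>count_space UNIV) = (1::ennreal)" for x :: real
  proof -
    have "(\<lambda>k::int. indicator {0..<1} (x - of_int k) :: ennreal) = indicator {\<lfloor>x\<rfloor>}"
      by (rule ext) (simp add: indicator_def, linarith)
    then show ?thesis by simp
  qed
  have meas [measurable]: "(\<lambda>x. ennreal (g (x + c))) \<in> borel_measurable borel" for c
    by (rule measurable_compose [of "\<lambda>x. x + c" _ borel]) measurable
  have "(\<integral>\<^sup>+x. ennreal (g x) * f x \<partial>lborel)
      = (\<integral>\<^sup>+x. (\<integral>\<^sup>+k. ennreal (g x) * f x * indicator {0..<1} (x - of_int k) \<partial>count_space UNIV) \<partial>lborel)"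
    by (simp add: nn_integral_cmult part)
  also have "\<dots> = (\<integral>\<^sup>+k. (\<integral>\<^sup>+x. ennreal (g x) * f x * indicator {0..<1} (x - of_int k) \<partial>lborel) \<partial>count_space UNIV)"
    by (rule nn_integral_count_space_nn_integral) auto
  also have "\<dots> = (\<integral>\<^sup>+k. (\<integral>\<^sup>+x. ennreal (g (x + of_int k)) * indicator {0..<1} x * f x \<partial>lborel) \<partial>count_space UNIV)"
  proof (rule nn_integral_cong)
    fix k :: int
    show "(\<integral>\<^sup>+x. ennreal (g x) * f x * indicator {0..<1} (x - of_int k) \<partial>lborel)
        = (\<integral>\<^sup>+x. ennreal (g (x + of_int k)) * indicator {0..<1} x * f x \<partial>lborel)"
      by (subst nn_integral_real_affine [where c = 1 and t = "of_int k"])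
         (auto simp: periodic add.commute [of "of_int k"] mult_ac)
  qed
  also have "\<dots> = (\<integral>\<^sup>+x. (\<integral>\<^sup>+k. ennreal (g (x + of_int k)) * indicator {0..<1} x * f x \<partial>count_space UNIV) \<partial>lborel)"
    by (rule nn_integral_count_space_nn_integral [symmetric]) auto
  also have "\<dots> = (\<integral>\<^sup>+x. wrap_mod1 g x * f x \<partial>lborel)"
    by (simp add: wrap_mod1_eq_nn_integral nn_integral_multc)
  finally show ?thesis .
qed

text \<open>Unwrapping in reverse: the left side is the integral of \<open>f\<close> over \<open>[a, a + 1)\<close>, and the
  indicator of that interval wraps to the constant \<open>1\<close> since every point of the circle has
  exactly one representative in it.\<close>

lemma nn_integral_period_translate:
  fixes f :: "real \<Rightarrow> ennreal"
  assumes [measurable]: "f \<in> borel_measurable borel"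
    and periodic: "\<And>x (k::int). f (x + of_int k) = f x"
  shows "(\<integral>\<^sup>+x\<in>{0..<1}. f (a + x) \<partial>lborel) = (\<integral>\<^sup>+x\<in>{0..<1}. f x \<partial>lborel)"
proof -
  let ?g = "indicator {a..<a + 1} :: real \<Rightarrow> real"
  have wrap: "wrap_mod1 ?g x = indicator {0..<1} x" for x
  proof -
    have "(\<lambda>k::int. ennreal (?g (x + of_int k))) = indicator {\<lceil>a - x\<rceil>}"
      by (rule ext) (simp add: indicator_def, linarith)
    then have "(\<integral>\<^sup>+k. ennreal (?g (x + of_int k)) \<partial>count_space UNIV) = (\<integral>\<^sup>+k. indicator {\<lceil>a - x\<rceil>} k \<partial>count_space UNIV)"
      by (rule arg_cong)
    also have "\<dots> = 1" by simp
    finally show ?thesis by (simp add: wrap_mod1_eq_nn_integral nn_integral_multc del: ennreal_indicator)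
  qed
  have "(\<integral>\<^sup>+x\<in>{0..<1}. f (a + x) \<partial>lborel) = (\<integral>\<^sup>+x. ennreal (?g x) * f x \<partial>lborel)"
    by (subst (2) nn_integral_real_affine [where c = 1 and t = a])
       (auto intro!: nn_integral_cong simp: indicator_def)
  also have "\<dots> = (\<integral>\<^sup>+x. wrap_mod1 ?g x * f x \<partial>lborel)"
    by (rule nn_integral_wrap_mod1) (auto simp: periodic)
  finally show ?thesis by (simp add: wrap mult.commute)
qed

section \<open>Significant digits and truncations\<close>

text \<open>Each truncation is ten times the previous one plus the next digit. The bound \<open>10\<close> on \<open>m\<close>
  and \<open>m'\<close> makes the integer part a single digit, which starts the induction.\<close>

lemma truncation_eq_iff_digits_eq:
  fixes m m' :: real
  assumes "0 \<le> m" "m < 10" "0 \<le> m'" "m' < 10"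
  shows "(\<forall>i\<le>n. \<lfloor>m * 10 ^ i\<rfloor> mod 10 = \<lfloor>m' * 10 ^ i\<rfloor> mod 10) \<longleftrightarrow> \<lfloor>m * 10 ^ n\<rfloor> = \<lfloor>m' * 10 ^ n\<rfloor>"
proof (induction n)
  case 0
  have "0 \<le> \<lfloor>m\<rfloor>" "\<lfloor>m\<rfloor> < 10" "0 \<le> \<lfloor>m'\<rfloor>" "\<lfloor>m'\<rfloor> < 10" using assms by linarith+
  then show ?case by simp
next
  case (Suc n)
  have "\<lfloor>x * 10 ^ Suc n\<rfloor> div 10 = \<lfloor>x * 10 ^ n\<rfloor>" for x :: real
    using floor_divide_real_eq_div [of 10 "x * 10 ^ Suc n"] by simp
  then have "\<lfloor>m * 10 ^ Suc n\<rfloor> = \<lfloor>m' * 10 ^ Suc n\<rfloor> \<longleftrightarrow>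
      \<lfloor>m * 10 ^ n\<rfloor> = \<lfloor>m' * 10 ^ n\<rfloor> \<and> \<lfloor>m * 10 ^ Suc n\<rfloor> mod 10 = \<lfloor>m' * 10 ^ Suc n\<rfloor> mod 10"
    by (metis mult_div_mod_eq)
  with Suc show ?case by (auto simp: le_Suc_eq)
qed

lemma significand_bounds:
  assumes "0 < y"
  shows "1 \<le> significand y" "significand y < 10"
  using theI' [OF significand_unique(1) [OF assms]] by (auto simp: significand_def)

lemma significand_powr: "significand (10 powr u) = 10 powr frac u"
  by (simp add: significand_unique(2) frac_def powr_diff powr_real_of_int')

lemma sig_digit_eq:
  assumes "0 < y"
  shows "sig_digit i y = nat (\<lfloor>significand y * 10 ^ (i - 1)\<rfloor> mod 10)"
  unfolding sig_digit_def
  by (rule decimal_expansion_unique(2)) (use significand_bounds [OF assms] in auto)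

lemma sig_digits_eq_iff:
  assumes "0 < y" "0 < y'"
  shows "(\<forall>i\<in>{1..Suc n}. sig_digit i y = sig_digit i y') \<longleftrightarrow>
    \<lfloor>significand y * 10 ^ n\<rfloor> = \<lfloor>significand y' * 10 ^ n\<rfloor>"
proof -
  have "(\<forall>i\<in>{1..Suc n}. sig_digit i y = sig_digit i y') \<longleftrightarrow> (\<forall>i\<le>n. sig_digit (Suc i) y = sig_digit (Suc i) y')"
    by (auto simp: Ball_def) (metis Suc_le_D Suc_le_mono)
  also have "\<dots> \<longleftrightarrow> (\<forall>i\<le>n. \<lfloor>significand y * 10 ^ i\<rfloor> mod 10 = \<lfloor>significand y' * 10 ^ i\<rfloor> mod 10)"
    using assms by (simp add: sig_digit_eq eq_nat_nat_iff)
  also have "\<dots> \<longleftrightarrow> \<lfloor>significand y * 10 ^ n\<rfloor> = \<lfloor>significand y' * 10 ^ n\<rfloor>"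
    using assms significand_bounds[of y] significand_bounds[of y']
    by (intro truncation_eq_iff_digits_eq) auto
  finally show ?thesis .
qed

lemma sig_digit_range:
  assumes "0 < y"
  shows "sig_digit 1 y \<in> {1..9}" "sig_digit i y \<in> {0..9}"
proof -
  have "1 \<le> \<lfloor>significand y\<rfloor>" "\<lfloor>significand y\<rfloor> \<le> 9"
    using significand_bounds [OF assms] by linarith+
  then show "sig_digit 1 y \<in> {1..9}" by (simp add: sig_digit_eq [OF assms] nat_le_iff le_nat_iff)
  have "\<lfloor>significand y * 10 ^ (i - 1)\<rfloor> mod 10 < 10" by simp
  then show "sig_digit i y \<in> {0..9}" unfolding sig_digit_eq [OF assms] by auto
qed

lemma sig_digit_powr_add_int:
  "sig_digit i (10 powr (u + of_int k)) = sig_digit i (10 powr u)"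
  by (simp add: sig_digit_eq significand_powr)

lemma measurable_sig_digit_powr [measurable]:
  "(\<lambda>u. sig_digit i (10 powr u)) \<in> measurable borel (count_space UNIV)"
proof -
  have "(\<lambda>u. sig_digit i (10 powr u)) = (\<lambda>u. nat (\<lfloor>10 powr frac u * 10 ^ (i - 1)\<rfloor> mod 10))"
    by (simp add: sig_digit_eq significand_powr)
  then show ?thesis unfolding frac_def by simp
qed

text \<open>For every \<open>z\<close>, the set where the truncation is \<open>z\<close> is empty or one of the events that
  scale-invariance speaks of. Any point of the set supplies the digits, so they need not be computed
  from \<open>z\<close>.\<close>

lemma truncation_event_cases:
  fixes z :: int
  obtains "\<And>u::real. \<lfloor>10 powr frac u * 10 ^ n\<rfloor> \<noteq> z"
  | d where "d 1 \<in> {1..9}" "\<And>i. d i \<in> {0..9}"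
      "\<And>u::real. \<lfloor>10 powr frac u * 10 ^ n\<rfloor> = z \<longleftrightarrow> (\<forall>i\<in>{1..Suc n}. sig_digit i (10 powr u) = d i)"
proof (cases "\<exists>u::real. \<lfloor>10 powr frac u * 10 ^ n\<rfloor> = z")
  case True
  then obtain v :: real where v: "\<lfloor>10 powr frac v * 10 ^ n\<rfloor> = z" by blast
  show thesis
  proof (rule that(2))
    show "sig_digit 1 (10 powr v) \<in> {1..9}" "sig_digit i (10 powr v) \<in> {0..9}" for i
      by (rule sig_digit_range; simp)+
    show "\<lfloor>10 powr frac u * 10 ^ n\<rfloor> = z \<longleftrightarrow>
        (\<forall>i\<in>{1..Suc n}. sig_digit i (10 powr u) = sig_digit i (10 powr v))" for u
      by (subst sig_digits_eq_iff) (auto simp: significand_powr v)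
  qed
qed (use that(1) in blast)

section \<open>Truncations determine a law\<close>

text \<open>The truncations of \<open>10 powr u\<close> increase to \<open>10 powr u\<close>, so the ray \<open>{t<..}\<close> is the increasing
  union of the sets where the \<open>n\<close>-th truncation exceeds \<open>10 powr t\<close>. Each of these is a countable
  disjoint union of sets on which the truncation is constant. For closed rays
  the union of the corresponding sets can miss the end point, since a truncation can stay below the
  number it truncates.\<close>

lemma measure_eqI_truncations:
  fixes \<mu> \<nu> :: "real measure"
  assumes sets: "sets \<mu> = sets borel" "sets \<nu> = sets borel"
    and fin: "finite_measure \<mu>"
    and eq: "\<And>n (z::int). emeasure \<mu> {u. \<lfloor>10 powr u * 10 ^ n\<rfloor> = z}
      = emeasure \<nu> {u. \<lfloor>10 powr u * 10 ^ n\<rfloor> = z}"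
  shows "\<mu> = \<nu>"
proof (rule measure_eqI_lessThan)
  note [measurable_cong] = sets
  define T where "T n u = of_int \<lfloor>10 powr u * 10 ^ n\<rfloor> / (10 ^ n :: real)" for n :: nat and u :: real
  fix t :: real
  define A where "A n = {u. 10 powr t < T n u}" for n :: nat
  define Z where "Z n = {z::int. 10 powr t < of_int z / 10 ^ n}" for n
  have A_UN: "A n = (\<Union>z\<in>Z n. {u. \<lfloor>10 powr u * 10 ^ n\<rfloor> = z})" for n
    by (auto simp: A_def Z_def T_def)
  have em: "emeasure \<mu> (A n) = emeasure \<nu> (A n)" for n
    unfolding A_UN
    by (subst (1 2) emeasure_UN_countable) (auto simp: disjoint_family_on_def eq sets)
  have "T n u \<le> T (Suc n) u" for n u
  proof -
    have "10 * of_int \<lfloor>10 powr u * 10 ^ n\<rfloor> \<le> 10 powr u * 10 ^ Suc n" by simp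
    then have "10 * \<lfloor>10 powr u * 10 ^ n\<rfloor> \<le> \<lfloor>10 powr u * 10 ^ Suc n\<rfloor>"
      by (subst le_floor_iff) simp
    then have "of_int (10 * \<lfloor>10 powr u * 10 ^ n\<rfloor>) \<le> (of_int \<lfloor>10 powr u * 10 ^ Suc n\<rfloor> :: real)"
      by (simp only: of_int_le_iff)
    then show ?thesis by (simp add: T_def field_simps)
  qed
  then have inc: "incseq A"
    by (auto simp: incseq_Suc_iff A_def intro: less_le_trans)
  have UN: "(\<Union>n. A n) = {t<..}"
  proof (intro equalityI subsetI)
    fix u assume "u \<in> (\<Union>n. A n)"
    then obtain n where "10 powr t < T n u" by (auto simp: A_def)
    also have "T n u \<le> 10 powr u" by (simp add: T_def pos_divide_le_eq)
    finally show "u \<in> {t<..}" by simp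
  next
    fix u assume "u \<in> {t<..}"
    then have pos: "0 < 10 powr u - 10 powr t" by simp
    then obtain n where n: "(1 / 10) ^ n < 10 powr u - 10 powr t"
      using real_arch_pow_inv [of "10 powr u - 10 powr t" "1 / 10"] by auto
    have "10 powr u - (1 / 10) ^ n = (10 powr u * 10 ^ n - 1) / 10 ^ n"
      by (simp add: diff_divide_distrib power_one_over)
    also have "\<dots> \<le> T n u"
      unfolding T_def by (rule divide_right_mono) (linarith, simp)
    finally have "10 powr t < T n u" using n by linarith
    then show "u \<in> (\<Union>n. A n)" by (auto simp: A_def)
  qed
  have [measurable]: "A n \<in> sets borel" for n
    unfolding A_def T_def by measurable
  have "emeasure \<mu> {t<..} = (SUP n. emeasure \<mu> (A n))"
    unfolding UN [symmetric] by (rule SUP_emeasure_incseq [symmetric]) (auto simp: inc sets)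
  also have "\<dots> = emeasure \<nu> {t<..}"
    unfolding UN [symmetric] em by (rule SUP_emeasure_incseq) (auto simp: inc sets)
  finally show "emeasure \<mu> {t<..} = emeasure \<nu> {t<..}" .
  show "emeasure \<mu> {t<..} < \<infinity>"
    using finite_measure.emeasure_finite [OF fin, of "{t<..}"] by (simp add: less_top)
qed (fact sets)+

section \<open>Laws modulo one\<close>

lemma distr_frac_eq_density_wrap_mod1:
  assumes X: "distributed M lborel X (\<lambda>x. ennreal (g x))"
  shows "distr M borel (\<lambda>\<omega>. frac (X \<omega>)) = density lborel (wrap_mod1 g)"
proof (rule measure_eqI)
  have [measurable]: "X \<in> borel_measurable M" "(\<lambda>x. ennreal (g x)) \<in> borel_measurable borel"
    using X by (auto simp: distributed_def)
  fix A assume "A \<in> sets (distr M borel (\<lambda>\<omega>. frac (X \<omega>)))"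
  then have [measurable]: "A \<in> sets borel" by simp
  have "emeasure (distr M borel (\<lambda>\<omega>. frac (X \<omega>))) A
      = (\<integral>\<^sup>+y. indicator A y \<partial>distr M borel (\<lambda>\<omega>. frac (X \<omega>)))" by simp
  also have "\<dots> = (\<integral>\<^sup>+\<omega>. indicator A (frac (X \<omega>)) \<partial>M)"
    by (rule nn_integral_distr) measurable
  also have "\<dots> = (\<integral>\<^sup>+x. ennreal (g x) * indicator A (frac x) \<partial>lborel)"
    by (rule distributed_nn_integral [OF X, symmetric]) measurable
  also have "\<dots> = (\<integral>\<^sup>+x. wrap_mod1 g x * indicator A (frac x) \<partial>lborel)"
    by (rule nn_integral_wrap_mod1) auto
  also have "\<dots> = (\<integral>\<^sup>+x. wrap_mod1 g x * indicator A x \<partial>lborel)"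
    by (rule nn_integral_cong) (simp add: wrap_mod1_def)
  also have "\<dots> = emeasure (density lborel (wrap_mod1 g)) A"
    by (simp add: emeasure_density)
  finally show "emeasure (distr M borel (\<lambda>\<omega>. frac (X \<omega>))) A = emeasure (density lborel (wrap_mod1 g)) A" .
qed simp

text \<open>After exchanging the integrals, the inner one runs over a period translated by \<open>X \<omega>\<close> and no
  longer depends on \<open>\<omega>\<close>. In other words, adding an independent uniform variable to \<open>X\<close> makes it
  uniform modulo \<open>1\<close>, whatever the law of \<open>X\<close>.\<close>

lemma (in prob_space) nn_integral_average_translations:
  fixes f :: "real \<Rightarrow> ennreal"
  assumes [measurable]: "X \<in> borel_measurable M" "f \<in> borel_measurable borel"
    and periodic: "\<And>x (k::int). f (x + of_int k) = f x"
  shows "(\<integral>\<^sup>+a\<in>{0..<1}. (\<integral>\<^sup>+\<omega>. f (a + X \<omega>) \<partial>M) \<partial>lborel) = (\<integral>\<^sup>+x\<in>{0..<1}. f x \<partial>lborel)"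
proof -
  interpret pair_sigma_finite M lborel ..
  have "(\<integral>\<^sup>+a\<in>{0..<1}. (\<integral>\<^sup>+\<omega>. f (a + X \<omega>) \<partial>M) \<partial>lborel)
      = (\<integral>\<^sup>+a. (\<integral>\<^sup>+\<omega>. f (a + X \<omega>) * indicator {0..<1} a \<partial>M) \<partial>lborel)"
    by (simp add: nn_integral_multc)
  also have "\<dots> = (\<integral>\<^sup>+\<omega>. (\<integral>\<^sup>+a\<in>{0..<1}. f (X \<omega> + a) \<partial>lborel) \<partial>M)"
    by (subst Fubini') (auto simp: add.commute)
  also have "\<dots> = (\<integral>\<^sup>+\<omega>. (\<integral>\<^sup>+x\<in>{0..<1}. f x \<partial>lborel) \<partial>M)"
    by (simp add: nn_integral_period_translate periodic)
  finally show ?thesis by (simp add: emeasure_space_1)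
qed

section \<open>Scale-invariance\<close>

theorem theorem2p4:
  fixes M :: "'a measure" and Y :: "'a \<Rightarrow> real" and g :: "real \<Rightarrow> real"
  assumes "prob_space M"
    and "Y \<in> borel_measurable M"
    and "\<And>\<omega>. \<omega> \<in> space M \<Longrightarrow> 0 < Y \<omega>"
    and "\<And>x. 0 \<le> g x"
    and "distributed M lborel (\<lambda>\<omega>. log 10 (Y \<omega>)) (\<lambda>x. ennreal (g x))"
  shows "scale_invariant M Y \<longleftrightarrow> (AE x\<in>{0..<1} in lborel. wrap_mod1 g x = 1)"
proof -
  interpret prob_space M by fact
  define X where "X = (\<lambda>\<omega>. log 10 (Y \<omega>))"
  have X: "distributed M lborel X (\<lambda>x. ennreal (g x))" using assms(5) by (simp add: X_def)
  then have [measurable]: "X \<in> borel_measurable M" "(\<lambda>x. ennreal (g x)) \<in> borel_measurable borel"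
    by (auto simp: distributed_def)
  define D where "D n d = {u. \<forall>i\<in>{1..n}. sig_digit i (10 powr u) = d i}" for n and d :: "nat \<Rightarrow> nat"
  have D [measurable]: "D n d \<in> sets borel" for n d
    unfolding D_def by measurable
  have D_periodic: "indicator (D n d) (u + of_int k) = (indicator (D n d) u :: ennreal)" for n d u k
    by (simp add: D_def indicator_def sig_digit_powr_add_int)
  define P where "P n d a = (\<integral>\<^sup>+\<omega>. indicator (D n d) (a + X \<omega>) \<partial>M)" for n d a
  have prob: "ennreal (\<P>(\<omega> in M. \<forall>i\<in>{1..n}. sig_digit i (c * Y \<omega>) = d i)) = P n d (log 10 c)"
    if "0 < c" for c n d
  proof -
    have "c * Y \<omega> = 10 powr (log 10 c + X \<omega>)" if "\<omega> \<in> space M" for \<omega>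
      using assms(3) [OF that] \<open>0 < c\<close> by (simp add: X_def powr_add)
    then have "{\<omega> \<in> space M. \<forall>i\<in>{1..n}. sig_digit i (c * Y \<omega>) = d i}
        = {\<omega> \<in> space M. log 10 c + X \<omega> \<in> D n d}"
      by (auto simp: D_def)
    moreover have "P n d (log 10 c) = (\<integral>\<^sup>+\<omega>. indicator {\<omega> \<in> space M. log 10 c + X \<omega> \<in> D n d} \<omega> \<partial>M)"
      unfolding P_def by (rule nn_integral_cong) (simp add: indicator_def)
    then have "P n d (log 10 c) = emeasure M {\<omega> \<in> space M. log 10 c + X \<omega> \<in> D n d}"
      by simp
    ultimately show ?thesis by (simp add: emeasure_eq_measure)
  qed
  have invariant_iff: "scale_invariant M Y \<longleftrightarrow>
      (\<forall>n\<ge>1. \<forall>d. d 1 \<in> {1..9} \<longrightarrow> (\<forall>i\<in>{2..n}. d i \<in> {0..9}) \<longrightarrow> (\<forall>a. P n d a = P n d 0))"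
  proof -
    have "(\<forall>c>0. \<P>(\<omega> in M. \<forall>i\<in>{1..n}. sig_digit i (c * Y \<omega>) = d i)
          = \<P>(\<omega> in M. \<forall>i\<in>{1..n}. sig_digit i (Y \<omega>) = d i)) \<longleftrightarrow> (\<forall>a. P n d a = P n d 0)"
      (is "(\<forall>c>0. ?p c = ?q) \<longleftrightarrow> _") for n d
    proof -
      have eq: "?p c = ?q \<longleftrightarrow> P n d (log 10 c) = P n d 0" if "0 < c" for c
        using prob [OF that, of n d] prob [of 1 n d] by (simp flip: ennreal_inj)
      show ?thesis
      proof
        assume "\<forall>c>0. ?p c = ?q"
        then have "P n d (log 10 (10 powr a)) = P n d 0" for a
          using eq [of "10 powr a"] by simp
        then show "\<forall>a. P n d a = P n d 0" by simp
      qed (use eq in blast)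
    qed
    then show ?thesis unfolding scale_invariant_def by blast
  qed
  show ?thesis
  proof
    assume inv: "scale_invariant M Y"
    \<comment> \<open>A probability that does not depend on the translation equals its average over all
      translations.\<close>
    have uniform: "P n d 0 = (\<integral>\<^sup>+x\<in>{0..<1}. indicator (D n d) x \<partial>lborel)"
      if "1 \<le> n" "d 1 \<in> {1..9}" "\<And>i. d i \<in> {0..9}" for n d
    proof -
      have const: "P n d a = P n d 0" for a using inv that invariant_iff by blast
      have "P n d 0 = (\<integral>\<^sup>+a\<in>{0..<1::real}. P n d 0 \<partial>lborel)"
        by (simp add: nn_integral_cmult_indicator)
      also have "\<dots> = (\<integral>\<^sup>+a\<in>{0..<1}. P n d a \<partial>lborel)"
        by (rule nn_integral_cong) (metis const)
      also have "\<dots> = (\<integral>\<^sup>+x\<in>{0..<1}. indicator (D n d) x \<partial>lborel)"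
        unfolding P_def by (rule nn_integral_average_translations) (auto simp: D_periodic)
      finally show ?thesis .
    qed
    let ?\<mu> = "distr M borel (\<lambda>\<omega>. frac (X \<omega>))" and ?\<nu> = "density lborel (indicator {0..<1}) :: real measure"
    have "?\<mu> = ?\<nu>"
    proof (rule measure_eqI_truncations)
      show "finite_measure ?\<mu>" by (intro finite_measure_distr) measurable
      fix n and z :: int
      let ?A = "{u::real. \<lfloor>10 powr u * 10 ^ n\<rfloor> = z}"
      have A: "?A \<in> sets borel" by measurable
      have \<mu>A: "emeasure ?\<mu> ?A = (\<integral>\<^sup>+\<omega>. indicator ?A (frac (X \<omega>)) \<partial>M)"
        using A by (subst nn_integral_indicator [symmetric], simp, subst nn_integral_distr) auto
      have \<nu>A: "emeasure ?\<nu> ?A = (\<integral>\<^sup>+x\<in>{0..<1}. indicator ?A (frac x) \<partial>lborel)"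
        using A by (subst emeasure_density) (auto intro!: nn_integral_cong simp: indicator_def)
      show "emeasure ?\<mu> ?A = emeasure ?\<nu> ?A"
      proof (cases rule: truncation_event_cases [of n z])
        case 1
        then show ?thesis unfolding \<mu>A \<nu>A by simp
      next
        case (2 d)
        then have "indicator ?A (frac u) = (indicator (D (Suc n) d) u :: ennreal)" for u
          by (simp add: D_def indicator_def)
        then show ?thesis
          using uniform [of "Suc n" d] 2 unfolding \<mu>A \<nu>A by (simp add: P_def)
      qed
    qed simp_all
    then have "density lborel (wrap_mod1 g) = density lborel (indicator {0..<1})"
      by (simp add: distr_frac_eq_density_wrap_mod1 [OF X])
    then have "AE x in lborel. wrap_mod1 g x = indicator {0..<1} x"
      by (intro sigma_finite_measure.density_unique [OF sigma_finite_lborel]) auto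
    then show "AE x\<in>{0..<1} in lborel. wrap_mod1 g x = 1" by eventually_elim auto
  next
    assume ae: "AE x\<in>{0..<1} in lborel. wrap_mod1 g x = 1"
    have "P n d a = (\<integral>\<^sup>+x\<in>{0..<1}. indicator (D n d) x \<partial>lborel)" for n d a
    proof -
      have "P n d a = (\<integral>\<^sup>+x. ennreal (g x) * indicator (D n d) (a + x) \<partial>lborel)"
        unfolding P_def by (rule distributed_nn_integral [OF X, symmetric]) measurable
      also have "\<dots> = (\<integral>\<^sup>+x. wrap_mod1 g x * indicator (D n d) (a + x) \<partial>lborel)"
        by (rule nn_integral_wrap_mod1) (auto simp: D_periodic simp flip: add.assoc)
      also have "\<dots> = (\<integral>\<^sup>+x\<in>{0..<1}. indicator (D n d) (a + x) \<partial>lborel)"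
        by (rule nn_integral_cong_AE) (use ae in eventually_elim, auto simp: wrap_mod1_def indicator_def)
      also have "\<dots> = (\<integral>\<^sup>+x\<in>{0..<1}. indicator (D n d) x \<partial>lborel)"
        by (rule nn_integral_period_translate) (auto simp: D_periodic)
      finally show ?thesis .
    qed
    then show "scale_invariant M Y" unfolding invariant_iff by simp
  qed
qed

end
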